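(* Let $p$ and $q$ be two different primes, and let $M = \langle r_n : n \in \mathbb{N} \rangle$ be a $p$-adic monoid generated by a sequence $(r_n)_{n \ge 1}$ of positive rationals such that $\lim_{n\to\infty} \mathsf{d}(r_n) = \infty$ and such that $\mathsf{n}(r_n)$ is a power of $q$ for every $n \in \mathbb{N}$. Then the following statements hold. (1) If $M$ is atomic, then $\lim_{n \to \infty} \mathsf{n}(r_n) = \infty$. (2) If $\lim_{n\to\infty} \mathsf{n}(r_n) = \infty$ and the sequence $(r_n)_{n \ge 1}$ is decreasing, then $M$ is atomic.
   Context: For a prime $p$, let $\mathbb{N}_0[1/p] = \{f(1/p) : f(x) \in \mathbb{N}_0[x]\}$; a $p$-adic monoid is a submonoid of the additive monoid $\mathbb{N}_0[1/p]$. For a positive rational $x$, $\mathsf{n}(x)$ and $\mathsf{d}(x)$ denote the unique relatively prime positive integers with $x = \mathsf{n}(x)/\mathsf{d}(x)$. A power of $q$ is an integer of the form $q^\beta$ with $\beta \in \mathbb{N}_0$. $\langle S \rangle$ denotes the additive submonoid generated by $S$. An atom of $M$ is an element $a \in M \setminus \{0\}$ such that $a = b+c$ with $b,c \in M$ implies $b=0$ or $c=0$. The monoid $M$ is atomic if every nonzero element of $M$ is a finite sum of atoms (repetitions allowed). Here $\mathbb{N} = \{1,2,3,\dots\}$ and $\mathbb{N}_0 = \mathbb{N} \cup \{0\}$. *)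

theory Defs
  imports "HOL-Computational_Algebra.Computational_Algebra"
begin

definition is_submonoid :: "'a::comm_monoid_add set \<Rightarrow> bool" where
  "is_submonoid M \<longleftrightarrow> 0 \<in> M \<and> (\<forall>x\<in>M. \<forall>y\<in>M. x + y \<in> M)"

definition generated_monoid :: "'a::comm_monoid_add set \<Rightarrow> 'a set" where
  "generated_monoid S = is_submonoid hull S"

definition monoid_atoms :: "'a::comm_monoid_add set \<Rightarrow> 'a set" where
  "monoid_atoms M =
     {a \<in> M - {0}. \<forall>b\<in>M. \<forall>c\<in>M. a = b + c \<longrightarrow> b = 0 \<or> c = 0}"

definition atomic_monoid :: "'a::comm_monoid_add set \<Rightarrow> bool" where
  "atomic_monoid M \<longleftrightarrow>
     (\<forall>x\<in>M - {0}. \<exists>A. set_mset A \<subseteq> monoid_atoms M \<and> x = sum_mset A)"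

definition nonneg_padics :: "nat \<Rightarrow> rat set" where
  "nonneg_padics p = {poly (map_poly of_nat f) (1 / of_nat p) | f :: nat poly. True}"

definition padic_monoid :: "nat \<Rightarrow> rat set \<Rightarrow> bool" where
  "padic_monoid p M \<longleftrightarrow> is_submonoid M \<and> M \<subseteq> nonneg_padics p"

(* quotient_of returns the lowest-terms representation with positive denominator,
   so for x > 0 both components are the coprime positive integers n(x) and d(x). *)

definition rat_num :: "rat \<Rightarrow> int" where
  "rat_num x = fst (quotient_of x)"

definition rat_den :: "rat \<Rightarrow> int" where
  "rat_den x = snd (quotient_of x)"

end

theory Submission
  imports Defs
begin

text \<open>Write r n = q ^ b n / p ^ a n, where a n tends to infinity.

(1) If the numerators do not tend to infinity, let B be least such that b n \<le> B for infinitely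
many n, so that b n = B for infinitely many n. Any generator r k with b k \<ge> B is a proper multiple
of r m for some m with b m = B and a m large. Hence the atoms lie among the finitely many r k with
b k < B and are bounded away from 0, whereas r m tends to 0 along the n with b n = B.

(2) If the numerators tend to infinity, only finitely many generators have numerator at most that
of r n, so every r n is a multiple of a generator g = q ^ \<beta> / p ^ \<alpha> such that every other generator
q ^ b / p ^ a has b > \<beta> or a < \<alpha>. Such a g is an atom: in a decomposition g = l + h, with l and h
sums of generators satisfying a < \<alpha> and b > \<beta> respectively, the number h has denominator at
most p ^ \<alpha>, hence is a multiple of q g, hence is 0; but then g = l has denominator below p ^ \<alpha>.\<close>

section \<open>Generated monoids and atoms\<close>

lemma submonoid_generated_monoid: "is_submonoid (generated_monoid S)"
  unfolding generated_monoid_def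
  by (rule hull_in) (auto simp: is_submonoid_def)

lemma generated_monoid_zero: "0 \<in> generated_monoid S"
  and generated_monoid_add:
    "x \<in> generated_monoid S \<Longrightarrow> y \<in> generated_monoid S \<Longrightarrow> x + y \<in> generated_monoid S"
  using submonoid_generated_monoid[of S] unfolding is_submonoid_def by blast+

lemma generated_monoid_incl: "x \<in> S \<Longrightarrow> x \<in> generated_monoid S"
  by (simp add: generated_monoid_def hull_inc)

lemma generated_monoid_of_nat_mult:
  fixes x :: "'a::comm_semiring_1"
  assumes "x \<in> generated_monoid S"
  shows "of_nat n * x \<in> generated_monoid S"
proof (induction n)
  case 0
  show ?case by (simp add: generated_monoid_zero)
next
  case (Suc n)
  then show ?case using assms by (simp add: distrib_right generated_monoid_add)
qed

text \<open>The members that satisfy \<open>P\<close> form a submonoid containing \<open>S\<close>,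
  so minimality of the hull applies. The addition case also supplies membership of both summands,
  which is what makes them usable as a decomposition inside the monoid.\<close>

lemma generated_monoid_induct [consumes 1, case_names zero incl add]:
  assumes "x \<in> generated_monoid S" and "P 0" and "\<And>x. x \<in> S \<Longrightarrow> P x"
    and "\<And>x y. x \<in> generated_monoid S \<Longrightarrow> P x \<Longrightarrow> y \<in> generated_monoid S \<Longrightarrow> P y \<Longrightarrow> P (x + y)"
  shows "P x"
proof -
  have "is_submonoid {x \<in> generated_monoid S. P x}"
    using assms(2,4) by (auto simp: is_submonoid_def generated_monoid_zero generated_monoid_add)
  moreover have "S \<subseteq> {x \<in> generated_monoid S. P x}"
    using assms(3) by (auto simp: generated_monoid_incl)
  ultimately have "generated_monoid S \<subseteq> {x \<in> generated_monoid S. P x}"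
    unfolding generated_monoid_def[of S] by (metis hull_minimal)
  then show ?thesis using assms(1) by blast
qed

lemma monoid_atoms_generated_subset: "monoid_atoms (generated_monoid S) \<subseteq> S"
proof
  fix a assume a: "a \<in> monoid_atoms (generated_monoid S)"
  then have "a \<in> generated_monoid S" by (simp add: monoid_atoms_def)
  \<comment> \<open>This disjunction survives addition: two nonzero summands are themselves the
    required splitting, and a zero summand leaves the other one's case unchanged. For an atom only
    the middle disjunct remains.\<close>
  then have "a = 0 \<or> a \<in> S \<or> (\<exists>y\<in>generated_monoid S. \<exists>z\<in>generated_monoid S. 
      y \<noteq> 0 \<and> z \<noteq> 0 \<and> a = y + z)"
  proof (induction rule: generated_monoid_induct)
    case (add x y)
    then show ?case by (cases "x = 0"; cases "y = 0") auto
  qed auto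
  then show "a \<in> S" using a by (auto simp: monoid_atoms_def)
qed

lemma not_atom_proper_multiple:
  fixes x :: rat
  assumes "x \<in> generated_monoid S" and "n \<ge> 2"
  shows "of_nat n * x \<notin> monoid_atoms (generated_monoid S)"
proof
  assume atom: "of_nat n * x \<in> monoid_atoms (generated_monoid S)"
  obtain k where n: "n = Suc (Suc k)"
    using assms(2) by (metis add_2_eq_Suc le_Suc_ex)
  have "of_nat n * x = x + of_nat (Suc k) * x" by (simp add: n algebra_simps)
  then have "x = 0 \<or> of_nat (Suc k) * x = 0"
    using atom generated_monoid_of_nat_mult[OF assms(1)] assms(1)
    unfolding monoid_atoms_def by blast
  then have "x = 0" using of_nat_eq_0_iff[where 'a = rat, of "Suc k"] by simp
  then show False using atom by (simp add: monoid_atoms_def)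
qed

text \<open>Factorizations of summands combine by multiset union, so it suffices to factor the
  generators. Repeating a single atom is enough for the application.\<close>

lemma atomic_generated_monoidI:
  fixes S :: "rat set"
  assumes "\<And>s. s \<in> S \<Longrightarrow> \<exists>g\<in>monoid_atoms (generated_monoid S). \<exists>n. s = of_nat n * g"
  shows "atomic_monoid (generated_monoid S)"
proof -
  have "\<exists>A. set_mset A \<subseteq> monoid_atoms (generated_monoid S) \<and> x = sum_mset A"
    if "x \<in> generated_monoid S" for x
    using that
  proof (induction rule: generated_monoid_induct)
    case zero
    show ?case by (rule exI[of _ "{#}"]) simp
  next
    case (incl s)
    then obtain g n where g: "g \<in> monoid_atoms (generated_monoid S)" "s = of_nat n * g"
      using assms by blast
    have "set_mset (replicate_mset n g) \<subseteq> monoid_atoms (generated_monoid S)"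
      using g(1) by (auto dest: in_replicate_mset[THEN iffD1])
    moreover have "s = sum_mset (replicate_mset n g)" using g(2) by simp
    ultimately show ?case by blast
  next
    case (add x y)
    then obtain A B where "set_mset A \<subseteq> monoid_atoms (generated_monoid S)" "x = sum_mset A"
      and "set_mset B \<subseteq> monoid_atoms (generated_monoid S)" "y = sum_mset B" by blast
    then have "set_mset (A + B) \<subseteq> monoid_atoms (generated_monoid S)" "x + y = sum_mset (A + B)"
      by auto
    then show ?case by blast
  qed
  then show ?thesis by (simp add: atomic_monoid_def)
qed

section \<open>Fractions of prime powers\<close>

lemma nonneg_padics_times_power:
  assumes "x \<in> nonneg_padics p" and "p > 0"
  shows "\<exists>k. x * of_nat p ^ k \<in> \<int>"
proof -
  obtain f :: "nat poly" where x: "x = poly (map_poly of_nat f) (1 / of_nat p)"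
    using assms(1) by (auto simp: nonneg_padics_def)
  have "\<exists>k. poly (map_poly of_nat f) (1 / rat_of_nat p) * of_nat p ^ k \<in> \<int>"
  proof (induction f)
    case 0
    show ?case by simp
  next
    case (pCons c f)
    then obtain k where k: "poly (map_poly of_nat f) (1 / rat_of_nat p) * of_nat p ^ k \<in> \<int>"
      by blast
    have "poly (map_poly of_nat (pCons c f)) (1 / rat_of_nat p) * of_nat p ^ Suc k
      = of_nat c * of_nat p ^ Suc k + poly (map_poly of_nat f) (1 / rat_of_nat p) * of_nat p ^ k"
      using assms(2) pCons(1) by (simp add: map_poly_pCons field_simps)
    then have "poly (map_poly of_nat (pCons c f)) (1 / rat_of_nat p) * of_nat p ^ Suc k \<in> \<int>"
      using k by simp
    then show ?case by blast
  qed
  then show ?thesis by (simp add: x)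
qed

text \<open>Some \<open>p ^ k\<close> clears the denominator of \<open>x\<close>. The reduced
  denominator is coprime to the numerator, hence divides \<open>p ^ k\<close>.\<close>

lemma rat_den_padic:
  assumes "prime p" and "x \<in> nonneg_padics p"
  shows "\<exists>a. rat_den x = int p ^ a"
proof -
  have p0: "p > 0" using assms(1) by (simp add: prime_gt_0_nat)
  obtain k where "x * of_nat p ^ k \<in> \<int>" using nonneg_padics_times_power[OF assms(2) p0] by blast
  then obtain z where z: "x * of_nat p ^ k = of_int z" by (auto elim: Ints_cases)
  obtain c d where cd: "quotient_of x = (c, d)" by fastforce
  have d0: "d > 0" by (rule quotient_of_denom_pos[OF cd])
  have cop: "coprime c d" by (rule quotient_of_coprime[OF cd])
  have "rat_of_int (c * int p ^ k) = of_int (z * d)"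
    using z d0 quotient_of_div[OF cd] by (simp add: field_simps)
  then have "c * int p ^ k = z * d" by (simp only: of_int_eq_iff)
  then have "d dvd int p ^ k" using cop
    by (metis coprime_commute coprime_dvd_mult_right_iff dvd_triv_right)
  then have "nat d dvd p ^ k" using d0
    by (metis int_dvd_int_iff int_nat_eq less_imp_le of_nat_power)
  then obtain a where "nat d = p ^ a" using divides_primepow_nat[OF assms(1)] by blast
  then have "d = int p ^ a" using d0 by (metis int_nat_eq less_imp_le of_nat_power)
  then show ?thesis by (auto simp: rat_den_def cd)
qed

lemma rat_eq_num_div_den: "x = of_int (rat_num x) / of_int (rat_den x)"
  by (simp add: rat_num_def rat_den_def quotient_of_div[OF prod.collapse[symmetric]])

text \<open>The disjunction in \<open>other\<close> fails for \<open>q ^ b / p ^ a\<close> exactly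
  when b \<le> \<beta> and a \<ge> \<alpha>, in which case \<open>g\<close> would be an integer
  multiple of that generator.\<close>

lemma prime_power_generator_atom:
  fixes S :: "rat set" and p q :: nat
  assumes p: "prime p" and q: "prime q" and pq: "p \<noteq> q"
    and gS: "g \<in> S" and g: "g = of_nat q ^ \<beta> / of_nat p ^ \<alpha>"
    and other: "\<And>s. s \<in> S \<Longrightarrow> s \<noteq> g \<Longrightarrow>
      \<exists>b a. s = of_nat q ^ b / of_nat p ^ a \<and> (b > \<beta> \<or> a < \<alpha>)"
  shows "g \<in> monoid_atoms (generated_monoid S)"
proof -
  have p0: "p > 0" and q0: "q > 0" using p q by (simp_all add: prime_gt_0_nat)
  have gpos: "g > 0" using p0 q0 by (simp add: g)
  have copq: "coprime q p" using p q pq by (metis primes_coprime)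
  \<comment> \<open>Normal form of an arbitrary element: \<open>n\<close> copies of
    \<open>g\<close>, a part from generators with a < \<alpha>, and a part from generators with b >
    \<beta>. Writing \<open>l * p\<close> over \<open>p ^ \<alpha>\<close> avoids the exponent
    \<alpha> - 1, and the last fraction need not be reduced, so sums keep this form.\<close>
  define F :: "nat \<Rightarrow> nat \<Rightarrow> nat \<Rightarrow> nat \<Rightarrow> rat" where
    "F n l h A = of_nat n * g + of_nat (l * p) / of_nat (p ^ \<alpha>) 
      + of_nat (h * q ^ Suc \<beta>) / of_nat (p ^ A)" for n l h A
  have F_pos: "F n l h A \<ge> of_nat n * g" for n l h A by (simp add: F_def)
  have F_add: "F n l h A + F n' l' h' A' = F (n + n') (l + l') (h * p ^ A' + h' * p ^ A) (A + A')"
    for n l h A n' l' h' A'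
    using p0 by (simp add: F_def field_simps power_add)
  have decomp: "\<exists>n l h A. x = F n l h A" if "x \<in> generated_monoid S" for x
    using that
  proof (induction rule: generated_monoid_induct)
    case zero
    have "0 = F 0 0 0 0" by (simp add: F_def)
    then show ?case by blast
  next
    case (incl s)
    show ?case
    proof (cases "s = g")
      case True
      then have "s = F 1 0 0 0" by (simp add: F_def)
      then show ?thesis by blast
    next
      case False
      then obtain b a where s: "s = of_nat q ^ b / of_nat p ^ a" and ba: "b > \<beta> \<or> a < \<alpha>"
        using other incl by blast
      from ba show ?thesis
      proof
        assume "b > \<beta>"
        then have "q ^ b = q ^ (b - Suc \<beta>) * q ^ Suc \<beta>"
          by (metis Suc_leI le_add_diff_inverse2 power_add)
        then have "s = F 0 0 (q ^ (b - Suc \<beta>)) a" by (simp add: F_def s flip: of_nat_power)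
        then show ?thesis by blast
      next
        assume "a < \<alpha>"
        then have "p ^ \<alpha> = p ^ (\<alpha> - Suc a) * p ^ Suc a"
          by (metis Suc_leI le_add_diff_inverse2 power_add)
        then have "p ^ \<alpha> = p ^ (\<alpha> - Suc a) * p * p ^ a" by simp
        then have "rat_of_nat (p ^ \<alpha>) = of_nat (p ^ (\<alpha> - Suc a)) * of_nat p * of_nat (p ^ a)"
          by (simp only: of_nat_mult)
        then have "s = F 0 (q ^ b * p ^ (\<alpha> - Suc a)) 0 0" 
          using p0 by (simp add: F_def s field_simps)
        then show ?thesis by blast
      qed
    qed
  next
    case (add x y)
    then show ?case using F_add by metis
  qed
  have no_split: False if "g = F 0 l h A" for l h A
  proof -
    have "rat_of_nat (q ^ \<beta> * p ^ A) = of_nat (l * p * p ^ A + p ^ \<alpha> * (h * q ^ Suc \<beta>))"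
      using that p0 unfolding g F_def by (simp add: field_simps)
    then have eq: "q ^ \<beta> * p ^ A = l * p * p ^ A + p ^ \<alpha> * (h * q ^ Suc \<beta>)"
      by (simp only: of_nat_eq_iff)
    \<comment> \<open>Subtraction is truncated, but \<open>eq\<close> gives l * p \<le> q ^ \<beta>.
      The difference is divisible by \<open>q ^ Suc \<beta>\<close> and smaller than it, so it
      vanishes; then \<open>p\<close> divides a power of \<open>q\<close>.\<close>
    then have "(q ^ \<beta> - l * p) * p ^ A = p ^ \<alpha> * h * q ^ Suc \<beta>"
      by (simp add: diff_mult_distrib)
    then have "q ^ Suc \<beta> dvd (q ^ \<beta> - l * p) * p ^ A" by simp
    moreover have "coprime (q ^ Suc \<beta>) (p ^ A)" using copq by simp
    ultimately have "q ^ Suc \<beta> dvd q ^ \<beta> - l * p" by (simp only: coprime_dvd_mult_left_iff)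
    moreover have "q ^ \<beta> - l * p < q ^ Suc \<beta>"
      using prime_gt_1_nat[OF q] by (simp add: less_imp_diff_less)
    ultimately have "q ^ \<beta> \<le> l * p" by (meson diff_is_0_eq nat_dvd_not_less neq0_conv)
    moreover have "l * p * p ^ A \<le> q ^ \<beta> * p ^ A" using eq by simp
    then have "l * p \<le> q ^ \<beta>" using p0 by simp
    ultimately have "p dvd q ^ \<beta>" by (metis dvd_triv_right le_antisym)
    then show False using p q pq by (metis prime_dvd_power primes_dvd_imp_eq)
  qed
  have "b = 0 \<or> c = 0" if b: "b \<in> generated_monoid S" and c: "c \<in> generated_monoid S"
    and gbc: "g = b + c" for b c
  proof -
    obtain n l h A where bF: "b = F n l h A" using decomp[OF b] by blast
    obtain n' l' h' A' where cF: "c = F n' l' h' A'" using decomp[OF c] by blast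
    have ge: "b \<ge> of_nat n * g" "c \<ge> of_nat n' * g" using F_pos bF cF by auto
    have "of_nat n * g \<ge> 0" "of_nat n' * g \<ge> 0" using gpos by simp_all
    then have nonneg: "b \<ge> 0" "c \<ge> 0" using ge by linarith+
    have ge_g: "of_nat k * g \<ge> g" if "k \<noteq> 0" for k
      using mult_right_mono[of 1 "of_nat k" g] gpos that by (simp add: Suc_leI)
    have "b \<ge> g" if "n \<noteq> 0" using ge_g[OF that] ge(1) by linarith
    moreover have "c \<ge> g" if "n' \<noteq> 0" using ge_g[OF that] ge(2) by linarith
    moreover
    \<comment> \<open>Otherwise the sum \<open>g\<close> would be a normal form without copies of
      \<open>g\<close>, against \<open>no_split\<close>. So one summand is already at least
      \<open>g\<close>, which forces the other, nonnegative one to be 0.\<close>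
    have "n \<noteq> 0 \<or> n' \<noteq> 0"
      using no_split gbc F_add[of 0 l h A 0] bF cF by (metis add_0)
    ultimately show ?thesis using nonneg gbc by auto
  qed
  then show ?thesis
    using gpos gS by (auto simp: monoid_atoms_def generated_monoid_incl)
qed

text \<open>Turns a limit into finiteness of the index sets with bounded exponent, the form in which
  both implications use it. Indices start at 1 because nothing is known about index 0.\<close>

lemma finite_indices_le_of_filterlim:
  fixes c :: nat and e :: "nat \<Rightarrow> nat" and f :: "nat \<Rightarrow> int"
  assumes "filterlim f at_top sequentially" and "\<And>n. n \<ge> 1 \<Longrightarrow> f n = int c ^ e n" and "c > 0"
  shows "finite {n. n \<ge> 1 \<and> e n \<le> K}"
proof -
  have "eventually (\<lambda>n. f n \<ge> int c ^ K + 1) sequentially"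
    using assms(1) by (simp add: filterlim_at_top)
  then obtain N where N: "\<And>n. n \<ge> N \<Longrightarrow> f n \<ge> int c ^ K + 1"
    by (auto simp: eventually_sequentially)
  have "n < N" if "n \<ge> 1" "e n \<le> K" for n
  proof (rule ccontr)
    assume "\<not> n < N"
    then have "int c ^ e n \<ge> int c ^ K + 1" using N[of n] assms(2)[OF that(1)] by simp
    moreover have "int c ^ e n \<le> int c ^ K" using that(2) assms(3) by (intro power_increasing) auto
    ultimately show False by simp
  qed
  then show ?thesis by (auto intro: bounded_nat_set_is_finite[of _ N])
qed

text \<open>For c \<ge> 2 an exponent is smaller than its power, so exponents above
  \<open>nat Z\<close> already push the values above \<open>Z\<close>.\<close>

lemma filterlim_of_finite_indices_le:
  fixes c :: nat and e :: "nat \<Rightarrow> nat" and f :: "nat \<Rightarrow> int"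
  assumes "\<And>K. finite {n. n \<ge> 1 \<and> e n \<le> K}" and "\<And>n. n \<ge> 1 \<Longrightarrow> f n = int c ^ e n" and "c \<ge> 2"
  shows "filterlim f at_top sequentially"
  unfolding filterlim_at_top
proof
  fix Z :: int
  have "finite {n. n \<ge> 1 \<and> e n \<le> nat Z}" by (rule assms(1))
  then obtain N where N: "\<And>n. n \<ge> 1 \<Longrightarrow> e n \<le> nat Z \<Longrightarrow> n < N"
    by (metis (mono_tags, lifting) finite_nat_set_iff_bounded mem_Collect_eq)
  have "Z \<le> f n" if "n \<ge> max 1 N" for n
  proof -
    have "nat Z < e n" using N[of n] that by (meson leI max.bounded_iff not_le)
    also have "e n < c ^ e n" using assms(3) by (intro power_gt_expt) auto
    finally have "Z < int (c ^ e n)" by linarith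
    then show ?thesis using assms(2)[of n] that by simp
  qed
  then show "eventually (\<lambda>n. Z \<le> f n) sequentially"
    unfolding eventually_sequentially by blast
qed

section \<open>The two implications\<close>

lemma finite_small_numerators_of_atomic:
  fixes p q :: nat and r :: "nat \<Rightarrow> rat" and a b :: "nat \<Rightarrow> nat"
  assumes p: "prime p" and q: "prime q"
    and r: "\<And>n. n \<ge> 1 \<Longrightarrow> r n = of_nat q ^ b n / of_nat p ^ a n"
    and fin: "\<And>K. finite {n. n \<ge> 1 \<and> a n \<le> K}"
    and atomic: "atomic_monoid (generated_monoid (r ` {1..}))"
  shows "finite {n. n \<ge> 1 \<and> b n \<le> K}"
proof (rule ccontr)
  let ?G = "generated_monoid (r ` {1..})"
  have p0: "p > 0" and q0: "q > 0" using p q by (simp_all add: prime_gt_0_nat)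
  assume inf: "infinite {n. n \<ge> 1 \<and> b n \<le> K}"
  define B where "B = (LEAST K. infinite {n. n \<ge> 1 \<and> b n \<le> K})"
  have infB: "infinite {n. n \<ge> 1 \<and> b n \<le> B}"
    unfolding B_def by (rule LeastI[of _ K]) (rule inf)
  have finB: "finite {n. n \<ge> 1 \<and> b n < B}"
  proof (cases B)
    case (Suc B')
    then have "finite {n. n \<ge> 1 \<and> b n \<le> B'}"
      using not_less_Least[of B' "\<lambda>K. infinite {n. n \<ge> 1 \<and> b n \<le> K}"] B_def by auto
    then show ?thesis by (simp add: Suc less_Suc_eq_le)
  qed simp
  have large: "\<exists>m\<ge>1. b m = B \<and> a m > k" for k
  proof -
    let ?X = "{n. n \<ge> 1 \<and> b n \<le> B} - ({n. n \<ge> 1 \<and> b n < B} \<union> {n. n \<ge> 1 \<and> a n \<le> k})"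
    have "infinite ?X" using infB finB fin by (intro Diff_infinite_finite) auto
    then have "?X \<noteq> {}" by (rule infinite_imp_nonempty)
    then obtain m where "m \<in> ?X" by (meson ex_in_conv)
    then show ?thesis by force
  qed
  have atom: "\<exists>k\<ge>1. x = r k \<and> b k < B" if x: "x \<in> monoid_atoms ?G" for x
  proof -
    obtain k where k: "k \<ge> 1" "x = r k" using monoid_atoms_generated_subset x by blast
    have "b k < B"
    proof (rule ccontr)
      assume "\<not> b k < B"
      then have bk: "q ^ b k = q ^ (b k - B) * q ^ B" by (simp flip: power_add)
      obtain m where m: "m \<ge> 1" "b m = B" "a m > a k" using large by blast
      have am: "p ^ a m = p ^ (a m - a k) * p ^ a k" using m(3) by (simp flip: power_add)
      \<comment> \<open>The quotient of \<open>r k\<close> by \<open>r m\<close>. It is at least 2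
        because \<open>a m > a k\<close> contributes a factor \<open>p\<close>.\<close>
      let ?c = "q ^ (b k - B) * p ^ (a m - a k)"
      have "r m \<in> ?G" using m(1) by (auto intro: generated_monoid_incl)
      moreover have "p ^ (a m - a k) \<ge> p ^ 1"
        using m(3) p0 by (intro power_increasing) auto
      then have "p ^ (a m - a k) \<ge> 2" using prime_ge_2_nat[OF p] by simp
      then have "?c \<ge> 2"
        using q0 mult_le_mono[of 1 "q ^ (b k - B)" 2 "p ^ (a m - a k)"] by simp
      moreover have "r k = of_nat ?c * r m"
        using p0 by (simp add: r[OF k(1)] r[OF m(1)] m(2) bk am divide_simps flip: of_nat_power)
      ultimately show False using not_atom_proper_multiple x k(2) by metis
    qed
    with k show ?thesis by blast
  qed
  \<comment> \<open>Every atom is at least \<open>1 / p ^ L\<close>, since its numerator is at least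
    1. The inserted 0 keeps \<open>Max\<close> meaningful when no index has
    \<open>b n < B\<close>.\<close>
  define L where "L = Max (insert 0 (a ` {n. n \<ge> 1 \<and> b n < B}))"
  have L: "a k \<le> L" if "k \<ge> 1" "b k < B" for k
    unfolding L_def using finB that by (intro Max_ge) auto
  \<comment> \<open>The extra \<open>q ^ B\<close> in the exponent absorbs the numerator of
    \<open>r m\<close>, as \<open>q ^ B < p ^ (q ^ B)\<close>. Thus \<open>r m\<close> lies below
    every atom.\<close>
  obtain m where m: "m \<ge> 1" "b m = B" "a m > L + q ^ B" using large by blast
  have rm: "r m < r k" if "k \<ge> 1" "b k < B" for k
  proof -
    have "q ^ B < p ^ (q ^ B)" using prime_gt_1_nat[OF p] by (intro power_gt_expt) auto
    then have "q ^ B * p ^ L < p ^ (L + q ^ B)" using p0 by (simp add: power_add)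
    also have "\<dots> \<le> p ^ a m" using m(3) p0 by (intro power_increasing) auto
    finally have lt: "q ^ B * p ^ L < p ^ a m" .
    have "p ^ a k \<le> p ^ L" using L[OF that] p0 by (intro power_increasing) auto
    then have "q ^ B * p ^ a k \<le> q ^ B * p ^ L" by simp
    also note lt
    also have "p ^ a m \<le> q ^ b k * p ^ a m" using q0 by simp
    finally have "rat_of_nat (q ^ B * p ^ a k) < of_nat (q ^ b k * p ^ a m)"
      by (simp only: of_nat_less_iff)
    then show ?thesis using p0 by (simp add: r[OF that(1)] r[OF m(1)] m(2) field_simps)
  qed
  have pos: "r k > 0" if "k \<ge> 1" for k using that p0 q0 by (simp add: r)
  have "r m \<in> ?G - {0}" using m(1) pos[OF m(1)] by (auto intro: generated_monoid_incl)
  then obtain A where A: "set_mset A \<subseteq> monoid_atoms ?G" "r m = sum_mset A"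
    using atomic unfolding atomic_monoid_def by blast
  \<comment> \<open>A positive element has at least one atom in its factorization, and that atom
    cannot exceed the element because the remaining atoms are nonnegative.\<close>
  have "A \<noteq> {#}" using A(2) pos[OF m(1)] by auto
  then obtain x A' where A': "A = add_mset x A'" by (meson multiset_cases)
  have nonneg: "y \<ge> 0" if "y \<in># A" for y
    using A(1) atom[of y] that pos by (metis less_imp_le subsetD)
  have "sum_mset A' \<ge> 0"
    using nonneg unfolding A' by (induction A') (auto intro: add_nonneg_nonneg)
  then have "x \<le> r m" using A(2) A' by simp
  moreover have "r m < x" using A(1) A' atom[of x] rm by auto
  ultimately show False by simp
qed

lemma atomic_of_finite_small_numerators:
  fixes p q :: nat and r :: "nat \<Rightarrow> rat" and a b :: "nat \<Rightarrow> nat"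
  assumes p: "prime p" and q: "prime q" and pq: "p \<noteq> q"
    and r: "\<And>n. n \<ge> 1 \<Longrightarrow> r n = of_nat q ^ b n / of_nat p ^ a n"
    and fin: "\<And>K. finite {n. n \<ge> 1 \<and> b n \<le> K}"
  shows "atomic_monoid (generated_monoid (r ` {1..}))"
proof (rule atomic_generated_monoidI)
  have p0: "p > 0" and q0: "q > 0" using p q by (simp_all add: prime_gt_0_nat)
  fix s assume "s \<in> r ` {1..}"
  then obtain n where n: "n \<ge> 1" "s = r n" by auto
  \<comment> \<open>Indices \<open>i\<close> for which \<open>r n\<close> is an integer multiple of
    \<open>r i\<close> by comparison of exponents. Bounded numerators make the set finite, so a
    generator of least value exists.\<close>
  let ?I = "{i. i \<ge> 1 \<and> b i \<le> b n \<and> a n \<le> a i}"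
  have "finite ?I" by (rule finite_subset[OF _ fin[of "b n"]]) auto
  moreover have "?I \<noteq> {}" using n by auto
  ultimately obtain i where i: "i \<in> ?I" and imin: "\<And>j. j \<in> ?I \<Longrightarrow> r i \<le> r j"
    using ex_is_arg_min_if_finite[of ?I r] by (auto simp: is_arg_min_linorder)
  have "\<exists>b' a'. t = of_nat q ^ b' / of_nat p ^ a' \<and> (b' > b i \<or> a' < a i)"
    if t: "t \<in> r ` {1..}" "t \<noteq> r i" for t
  proof -
    obtain j where j: "j \<ge> 1" "t = r j" using t(1) by auto
    \<comment> \<open>A violating \<open>j\<close> would again lie in the index set and satisfy r j
      \<le> r i, so minimality would give equal values, although \<open>t\<close> differs from
      \<open>r i\<close>.\<close>
    have "b j > b i \<or> a j < a i"
    proof (rule ccontr)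
      assume "\<not> (b j > b i \<or> a j < a i)"
      then have ba: "b j \<le> b i" "a i \<le> a j" by auto
      have "r j \<le> r i"
        using i j(1) p0 q0 ba by (auto simp: r intro!: frac_le power_increasing)
      moreover have "r i \<le> r j" using imin[of j] i j(1) ba by auto
      ultimately show False using t(2) j(2) by simp
    qed
    then show ?thesis using r j by blast
  qed
  then have "r i \<in> monoid_atoms (generated_monoid (r ` {1..}))"
    using i r by (intro prime_power_generator_atom[OF p q pq, of _ _ "b i" "a i"]) auto
  moreover have "s = of_nat (q ^ (b n - b i) * p ^ (a i - a n)) * r i"
  proof -
    have "q ^ b n = q ^ (b n - b i) * q ^ b i" "p ^ a i = p ^ (a i - a n) * p ^ a n"
      using i by (simp_all flip: power_add)
    then show ?thesis using i n p0 by (simp add: r divide_simps flip: of_nat_power)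
  qed
  ultimately show "\<exists>g\<in>monoid_atoms (generated_monoid (r ` {1..})). \<exists>n. s = of_nat n * g"
    by blast
qed

theorem theorem5p5:
  fixes p q :: nat and r :: "nat \<Rightarrow> rat" and M :: "rat set"
  assumes "prime p" and "prime q" and "p \<noteq> q"
    and "\<And>n. n \<ge> 1 \<Longrightarrow> r n > 0"
    and "M = generated_monoid (r ` {1..})"
    and "padic_monoid p M"
    and "filterlim (\<lambda>n. rat_den (r n)) at_top sequentially"
    and "\<And>n. n \<ge> 1 \<Longrightarrow> \<exists>\<beta>::nat. rat_num (r n) = int q ^ \<beta>"
  shows "(atomic_monoid M \<longrightarrow> filterlim (\<lambda>n. rat_num (r n)) at_top sequentially) \<and>
         (filterlim (\<lambda>n. rat_num (r n)) at_top sequentially \<and> antimono_on {1..} r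
            \<longrightarrow> atomic_monoid M)"
proof -
  obtain b where b: "\<And>n. n \<ge> 1 \<Longrightarrow> rat_num (r n) = int q ^ b n"
    using assms(8) by metis
  have "\<exists>a. rat_den (r n) = int p ^ a" if "n \<ge> 1" for n
  proof (rule rat_den_padic[OF assms(1)])
    have "r n \<in> M" using that by (auto simp: assms(5) intro: generated_monoid_incl)
    then show "r n \<in> nonneg_padics p" using assms(6) by (auto simp: padic_monoid_def)
  qed
  then obtain a where a: "\<And>n. n \<ge> 1 \<Longrightarrow> rat_den (r n) = int p ^ a n"
    by metis
  have r: "r n = of_nat q ^ b n / of_nat p ^ a n" if "n \<ge> 1" for n
    using rat_eq_num_div_den[of "r n"] that by (simp add: a b)
  have fin: "finite {n. n \<ge> 1 \<and> a n \<le> K}" for K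
    using finite_indices_le_of_filterlim[OF assms(7) a] assms(1) by (simp add: prime_gt_0_nat)
  have "filterlim (\<lambda>n. rat_num (r n)) at_top sequentially" if "atomic_monoid M"
  proof (rule filterlim_of_finite_indices_le)
    show "finite {n. n \<ge> 1 \<and> b n \<le> K}" for K
      using finite_small_numerators_of_atomic[OF assms(1,2) r fin] that assms(5) by blast
  qed (use b prime_ge_2_nat[OF assms(2)] in auto)
  moreover have "atomic_monoid M" if "filterlim (\<lambda>n. rat_num (r n)) at_top sequentially"
    unfolding assms(5)
  proof (rule atomic_of_finite_small_numerators[OF assms(1-3) r])
    show "finite {n. n \<ge> 1 \<and> b n \<le> K}" for K
      using finite_indices_le_of_filterlim[OF that b] assms(2) by (simp add: prime_gt_0_nat)
  qed
  ultimately show ?thesis by blast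
qed

end
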